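(* Let $f=(f_1,f_2)$ and $\tilde f=(\tilde f_1,\tilde f_2)$ be the vector-valued fractal functions interpolating the same generalised data set $V^*=\{(t_j,u_j,v_j):j=0,1,\ldots,N\}$ corresponding to the iterated function systems $\mathcal{I}$ and $\tilde{\mathcal{I}}$ described in the context (which share $L_j,s_j,r_j$ and have vertical scaling functions $\alpha_j,\beta_j,\gamma_j,\delta_j$ and $\tilde\alpha_j,\tilde\beta_j,\tilde\gamma_j,\tilde\delta_j$, respectively). Let $\alpha=\max_j\|\alpha_j\|_\infty$, $\beta=\max_j\|\beta_j\|_\infty$, $\gamma=\max_j\|\gamma_j\|_\infty$, $\delta=\max_j\|\delta_j\|_\infty$, and assume $(1-\alpha)(1-\delta)-\beta\gamma>0$. Then $$\|f_1-\tilde f_1\|_\infty<\frac{1-\delta}{(1-\alpha)(1-\delta)-\beta\gamma}\Big(\|s\|_{\infty}\Delta_{\alpha}+\|r\|_\infty\Delta_{\beta}+\Delta_{p}\Big)+\frac{\beta}{(1-\alpha)(1-\delta)-\beta\gamma}\Big(\|s\|_{\infty}\Delta_\gamma+\|r\|_{\infty}\Delta_{\delta}+\Delta_{q}\Big),$$ where $\|s\|_\infty=\max_{j}\sup_{(u,v)\in K}|s_j(u)|$, $\|r\|_\infty=\max_j\sup_{(u,v)\in K}|r_j(v)|$, and, for each symbol $g\in\{\alpha,\beta,\gamma,\delta,p,q\}$, $\Delta_g=\max_{1\le j\le N}\|g_j-\tilde g_j\|_\infty$.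
   Context: Let $I=[0,1]$, $N\ge 2$, $0=t_0<t_1<\cdots<t_N=1$, and $V^*=\{(t_j,u_j,v_j):j=0,\ldots,N\}\subset I\times\mathbb{R}^2$. Let $I_j=[t_{j-1},t_j]$ and let $L_j:I\to I_j$ be $L_j(t)=\frac{t_j-t_{j-1}}{t_N-t_0}(t-t_0)+t_{j-1}$ for $j=1,\ldots,N$. A map $T$ of a metric space $(X,d)$ into itself is an Edelstein contraction if $d(Tx,Ty)<d(x,y)$ for all $x\ne y$. Let $s_j,r_j:\mathbb{R}\to\mathbb{R}$ be Edelstein contractions ($j=1,\ldots,N$). For $g:I\to\mathbb{R}$, $\|g\|_\infty=\sup_{t\in I}|g(t)|$. System $\mathcal{I}$: let $\alpha_j,\beta_j,\gamma_j,\delta_j,p_j,q_j:I\to\mathbb{R}$ be Lipschitz with $\|\alpha_j\|_\infty+\|\gamma_j\|_\infty\le 1$ and $\|\beta_j\|_\infty+\|\delta_j\|_\infty\le 1$, such that $$F_j(t,u,v)=\big(\alpha_j(t)s_j(u)+\beta_j(t)r_j(v)+p_j(t),\ \gamma_j(t)s_j(u)+\delta_j(t)r_j(v)+q_j(t)\big)$$ satisfies $F_j(t_0,u_0,v_0)=(u_{j-1},v_{j-1})$ and $F_j(t_N,u_N,v_N)=(u_j,v_j)$ for $j=1,\ldots,N$. System $\tilde{\mathcal{I}}$: let $\tilde\alpha_j,\tilde\beta_j,\tilde\gamma_j,\tilde\delta_j,\tilde p_j,\tilde q_j$ be functions satisfying the same conditions, with the same $s_j,r_j$ and the same data set $V^*$,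 defining maps $\tilde F_j$ by the same formula. Let $K\subset\mathbb{R}^2$ be a nonempty compact set with $F_j(I\times K)\subset K$ and $\tilde F_j(I\times K)\subset K$ for all $j$. Then $\mathcal{I}=\{I\times K,(L_j,F_j):j=1,\ldots,N\}$ and $\tilde{\mathcal{I}}=\{I\times K,(L_j,\tilde F_j):j=1,\ldots,N\}$. The vector-valued fractal function $f=(f_1,f_2)$ corresponding to $\mathcal{I}$ is the unique continuous $f:I\to\mathbb{R}^2$ with $f(t_j)=(u_j,v_j)$ for $j=0,\ldots,N$ and $f(L_j(t))=F_j(t,f(t))$ for all $t\in I$, $j=1,\ldots,N$; its graph is the attractor of $\mathcal{I}$. The function $\tilde f=(\tilde f_1,\tilde f_2)$ is defined likewise from $\tilde{\mathcal{I}}$.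
   Formalization: The strict < is false in general (identical systems give 0<0); proved instead: ≤ always, and strict < whenever the right-hand side exceeds its first bracket ‖s‖Δ_α+‖r‖Δ_β+Δ_p. *)

theory Defs
  imports "HOL-Analysis.Analysis"
begin

text \<open>
  Functions on the interval [0,1] are total functions on the reals; only their values on
  \<^term>\<open>{0..1::real}\<close> matter. Families \<open>g\<^sub>j\<close> with \<open>1 \<le> j \<le> N\<close> are functions
  \<open>nat \<Rightarrow> real \<Rightarrow> real\<close>, used only at indices in \<open>{1..N}\<close>.
\<close>

definition edelstein_contraction :: "('a::metric_space \<Rightarrow> 'a) \<Rightarrow> bool" where
  "edelstein_contraction T \<longleftrightarrow> (\<forall>x y. x \<noteq> y \<longrightarrow> dist (T x) (T y) < dist x y)"

definition lipschitz_unit :: "(real \<Rightarrow> real) \<Rightarrow> bool" where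
  "lipschitz_unit g \<longleftrightarrow> (\<exists>C. C-lipschitz_on {0..1} g)"

text \<open>The suprema below are real-valued; under the hypotheses of the theorem all the sets
  involved are nonempty and bounded.\<close>

definition sup_norm :: "(real \<Rightarrow> real) \<Rightarrow> real" where
  "sup_norm g = (SUP x\<in>{0..1}. \<bar>g x\<bar>)"

definition max_sup_norm :: "nat \<Rightarrow> (nat \<Rightarrow> real \<Rightarrow> real) \<Rightarrow> real" where
  "max_sup_norm N g = Max ((\<lambda>j. sup_norm (g j)) ` {1..N})"

definition max_sup_dist :: "nat \<Rightarrow> (nat \<Rightarrow> real \<Rightarrow> real) \<Rightarrow> (nat \<Rightarrow> real \<Rightarrow> real) \<Rightarrow> real" where
  "max_sup_dist N g g' = Max ((\<lambda>j. sup_norm (\<lambda>x. g j x - g' j x)) ` {1..N})"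

definition max_sup_fst :: "nat \<Rightarrow> (real \<times> real) set \<Rightarrow> (nat \<Rightarrow> real \<Rightarrow> real) \<Rightarrow> real" where
  "max_sup_fst N K s = Max ((\<lambda>j. SUP (u, v)\<in>K. \<bar>s j u\<bar>) ` {1..N})"

definition max_sup_snd :: "nat \<Rightarrow> (real \<times> real) set \<Rightarrow> (nat \<Rightarrow> real \<Rightarrow> real) \<Rightarrow> real" where
  "max_sup_snd N K r = Max ((\<lambda>j. SUP (u, v)\<in>K. \<bar>r j v\<bar>) ` {1..N})"

definition unit_partition :: "nat \<Rightarrow> (nat \<Rightarrow> real) \<Rightarrow> bool" where
  "unit_partition N t \<longleftrightarrow> t 0 = 0 \<and> t N = 1 \<and> (\<forall>j<N. t j < t (Suc j))"

definition L_map :: "nat \<Rightarrow> (nat \<Rightarrow> real) \<Rightarrow> nat \<Rightarrow> real \<Rightarrow> real" where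
  "L_map N t j x = (t j - t (j - 1)) / (t N - t 0) * (x - t 0) + t (j - 1)"

definition F_map ::
  "(nat \<Rightarrow> real \<Rightarrow> real) \<Rightarrow> (nat \<Rightarrow> real \<Rightarrow> real) \<Rightarrow>
   (nat \<Rightarrow> real \<Rightarrow> real) \<Rightarrow> (nat \<Rightarrow> real \<Rightarrow> real) \<Rightarrow> (nat \<Rightarrow> real \<Rightarrow> real) \<Rightarrow>
   (nat \<Rightarrow> real \<Rightarrow> real) \<Rightarrow> (nat \<Rightarrow> real \<Rightarrow> real) \<Rightarrow> (nat \<Rightarrow> real \<Rightarrow> real) \<Rightarrow>
   nat \<Rightarrow> real \<Rightarrow> real \<times> real \<Rightarrow> real \<times> real" where
  "F_map s r \<alpha> \<beta> \<gamma> \<delta> p q j x = (\<lambda>(u, v).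
     (\<alpha> j x * s j u + \<beta> j x * r j v + p j x,
      \<gamma> j x * s j u + \<delta> j x * r j v + q j x))"

text \<open>Conditions on the coefficient functions of one system over the data
  \<open>(t\<^sub>j, u\<^sub>j, v\<^sub>j)\<close>: Lipschitz continuity, bounds on the vertical scaling functions, and
  the join-up conditions.\<close>

definition admissible_system ::
  "nat \<Rightarrow> (nat \<Rightarrow> real) \<Rightarrow> (nat \<Rightarrow> real) \<Rightarrow> (nat \<Rightarrow> real) \<Rightarrow>
   (nat \<Rightarrow> real \<Rightarrow> real) \<Rightarrow> (nat \<Rightarrow> real \<Rightarrow> real) \<Rightarrow>
   (nat \<Rightarrow> real \<Rightarrow> real) \<Rightarrow> (nat \<Rightarrow> real \<Rightarrow> real) \<Rightarrow> (nat \<Rightarrow> real \<Rightarrow> real) \<Rightarrow>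
   (nat \<Rightarrow> real \<Rightarrow> real) \<Rightarrow> (nat \<Rightarrow> real \<Rightarrow> real) \<Rightarrow> (nat \<Rightarrow> real \<Rightarrow> real) \<Rightarrow> bool" where
  "admissible_system N t u v s r \<alpha> \<beta> \<gamma> \<delta> p q \<longleftrightarrow> (\<forall>j\<in>{1..N}.
     lipschitz_unit (\<alpha> j) \<and> lipschitz_unit (\<beta> j) \<and> lipschitz_unit (\<gamma> j) \<and>
     lipschitz_unit (\<delta> j) \<and> lipschitz_unit (p j) \<and> lipschitz_unit (q j) \<and>
     sup_norm (\<alpha> j) + sup_norm (\<gamma> j) \<le> 1 \<and>
     sup_norm (\<beta> j) + sup_norm (\<delta> j) \<le> 1 \<and>
     F_map s r \<alpha> \<beta> \<gamma> \<delta> p q j (t 0) (u 0, v 0) = (u (j - 1), v (j - 1)) \<and>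
     F_map s r \<alpha> \<beta> \<gamma> \<delta> p q j (t N) (u N, v N) = (u j, v j))"

definition invariant_fibre ::
  "nat \<Rightarrow> (real \<times> real) set \<Rightarrow> (nat \<Rightarrow> real \<Rightarrow> real \<times> real \<Rightarrow> real \<times> real) \<Rightarrow> bool" where
  "invariant_fibre N K F \<longleftrightarrow> (\<forall>j\<in>{1..N}. \<forall>x\<in>{0..1}. F j x ` K \<subseteq> K)"

text \<open>Under the hypotheses of the theorem, exactly one function on [0,1] has the property below,
  so it characterises the vector-valued fractal function of the system.\<close>

definition vector_fractal_function ::
  "nat \<Rightarrow> (nat \<Rightarrow> real) \<Rightarrow> (nat \<Rightarrow> real) \<Rightarrow> (nat \<Rightarrow> real) \<Rightarrow>
   (nat \<Rightarrow> real \<Rightarrow> real \<times> real \<Rightarrow> real \<times> real) \<Rightarrow> (real \<Rightarrow> real \<times> real) \<Rightarrow> bool" where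
  "vector_fractal_function N t u v F f \<longleftrightarrow>
     continuous_on {0..1} f \<and>
     (\<forall>j\<in>{0..N}. f (t j) = (u j, v j)) \<and>
     (\<forall>j\<in>{1..N}. \<forall>x\<in>{0..1}. f (L_map N t j x) = F j x (f x))"

text \<open>
  The strict inequality between the distance of the first components and its bound cannot hold
  in general. If the two systems coincide, both sides are 0. If all vertical scaling functions of
  both systems vanish, both sides equal \<open>max_sup_dist N p p'\<close>, which may be positive. The
  theorem, whose notation is used here, asserts the non-strict inequality always, and the
  strict one whenever the bound exceeds its value \<open>A\<close> at \<open>a = b = 0\<close>; since \<open>A, B \<ge> 0\<close>, this means
  \<open>b * B > 0\<close>, or \<open>A > 0\<close> and \<open>a > 0 \<or> b * c > 0\<close>.
\<close>

end

theory Submission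
  imports Defs
begin

text \<open>
  In the taxicab metric of the plane every fibre map strictly decreases the distance of distinct
  points, and every point of [0,1] lies in the range of some \<open>L\<^sub>j\<close>. Comparing a point where the
  distance of a fractal function from \<open>K\<close> is maximal with its preimage under \<open>L\<^sub>j\<close> shows that
  the function takes values in \<open>K\<close>. Let \<open>X\<close> and \<open>Y\<close> be the maxima of the distances between the first
  and the second components. Evaluating the functional equations at the points where these are
  attained gives \<open>X \<le> a X + b Y + A\<close> and \<open>Y \<le> c X + d Y + B\<close>, and eliminating \<open>Y\<close> yields the bound.
  As \<open>s\<^sub>j\<close> and \<open>r\<^sub>j\<close> strictly decrease distances, the first inequality is strict if \<open>a X > 0\<close> or
  \<open>b Y > 0\<close>; otherwise \<open>X \<le> A\<close>.
\<close>

section \<open>Edelstein contractions\<close>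

lemma edelstein_contraction_dist_le:
  assumes "edelstein_contraction T"
  shows "dist (T x) (T y) \<le> dist x y"
  using assms by (cases "x = y") (auto simp: edelstein_contraction_def less_imp_le)

lemma edelstein_contraction_continuous:
  assumes "edelstein_contraction T"
  shows "continuous_on S T"
proof -
  have "1-lipschitz_on S T"
    by (rule lipschitz_onI) (simp_all add: edelstein_contraction_dist_le[OF assms])
  then show ?thesis by (rule lipschitz_on_continuous_on)
qed

lemma edelstein_contraction_abs_le:
  fixes x y :: real
  assumes "edelstein_contraction T" "\<bar>x - y\<bar> \<le> M"
  shows "\<bar>T x - T y\<bar> \<le> M"
  using edelstein_contraction_dist_le[OF assms(1), of x y] assms(2) by (simp add: dist_real_def)

text \<open>If \<open>x = y\<close> the left-hand side is 0, whence the assumption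
  \<open>0 < M\<close>. The bound \<open>M\<close> need not be the distance itself; it will be a
  supremum norm.\<close>

lemma edelstein_contraction_abs_less:
  fixes x y :: real
  assumes "edelstein_contraction T" "\<bar>x - y\<bar> \<le> M" "0 < M"
  shows "\<bar>T x - T y\<bar> < M"
  using assms by (cases "x = y") (force simp: edelstein_contraction_def dist_real_def)+

section \<open>Supremum norms and their maxima over the indices\<close>

lemma lipschitz_unit_continuous: "lipschitz_unit g \<Longrightarrow> continuous_on {0..1} g"
  unfolding lipschitz_unit_def using lipschitz_on_continuous_on by blast

lemma sup_norm_attained:
  assumes "continuous_on {0..1} g"
  obtains x where "x \<in> {0..1}" "sup_norm g = \<bar>g x\<bar>" "\<And>y. y \<in> {0..1} \<Longrightarrow> \<bar>g y\<bar> \<le> \<bar>g x\<bar>"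
proof -
  have "continuous_on {0..1} (\<lambda>x. \<bar>g x\<bar>)"
    using assms by (intro continuous_intros)
  then obtain x where x: "x \<in> {0..1}" "\<And>y. y \<in> {0..1} \<Longrightarrow> \<bar>g y\<bar> \<le> \<bar>g x\<bar>"
    using continuous_attains_sup[of "{0..1::real}" "\<lambda>x. \<bar>g x\<bar>"] by auto
  then have "sup_norm g = \<bar>g x\<bar>"
    unfolding sup_norm_def by (intro cSup_eq_maximum) auto
  with x that show thesis by blast
qed

lemma abs_le_sup_norm:
  assumes "continuous_on {0..1} g" "x \<in> {0..1}"
  shows "\<bar>g x\<bar> \<le> sup_norm g"
  using assms sup_norm_attained by metis

lemma sup_norm_nonneg:
  assumes "continuous_on {0..1} g"
  shows "0 \<le> sup_norm g"
  using sup_norm_attained[OF assms] by (metis abs_ge_zero)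

lemma sup_norm_le_max_sup_norm: "j \<in> {1..N} \<Longrightarrow> sup_norm (g j) \<le> max_sup_norm N g"
  unfolding max_sup_norm_def by (intro Max_ge) auto

lemma max_sup_dist_conv_max_sup_norm: "max_sup_dist N g g' = max_sup_norm N (\<lambda>j x. g j x - g' j x)"
  unfolding max_sup_dist_def max_sup_norm_def ..

lemma abs_le_max_sup_norm:
  assumes "\<And>j. j \<in> {1..N} \<Longrightarrow> continuous_on {0..1} (g j)" "j \<in> {1..N}" "x \<in> {0..1}"
  shows "\<bar>g j x\<bar> \<le> max_sup_norm N g"
  using abs_le_sup_norm sup_norm_le_max_sup_norm assms by (meson order_trans)

lemma abs_diff_le_max_sup_dist:
  assumes "\<And>j. j \<in> {1..N} \<Longrightarrow> continuous_on {0..1} (g j)"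
    "\<And>j. j \<in> {1..N} \<Longrightarrow> continuous_on {0..1} (g' j)" "j \<in> {1..N}" "x \<in> {0..1}"
  shows "\<bar>g j x - g' j x\<bar> \<le> max_sup_dist N g g'"
  unfolding max_sup_dist_conv_max_sup_norm
  by (rule abs_le_max_sup_norm) (use assms in \<open>auto intro: continuous_on_diff\<close>)

lemma max_sup_norm_le:
  assumes "1 \<le> N" "\<And>j. j \<in> {1..N} \<Longrightarrow> sup_norm (g j) \<le> M"
  shows "max_sup_norm N g \<le> M"
  unfolding max_sup_norm_def using assms by (subst Max_le_iff) auto

text \<open>Compactness of \<open>K\<close> makes each supremum finite. The general domain type
  covers both \<open>s j (fst z)\<close> and \<open>r j (snd z)\<close> as functions of the pair
  \<open>z\<close>.\<close>

lemma abs_le_max_SUP: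
  fixes h :: "nat \<Rightarrow> 'a::topological_space \<Rightarrow> real"
  assumes "compact K" "continuous_on K (h j)" "j \<in> {1..N}" "z \<in> K"
  shows "\<bar>h j z\<bar> \<le> Max ((\<lambda>j. SUP z\<in>K. \<bar>h j z\<bar>) ` {1..N})"
proof -
  have "compact ((\<lambda>z. \<bar>h j z\<bar>) ` K)"
    using assms by (intro compact_continuous_image continuous_intros)
  then have "bdd_above ((\<lambda>z. \<bar>h j z\<bar>) ` K)"
    by (intro bounded_imp_bdd_above compact_imp_bounded)
  then have "\<bar>h j z\<bar> \<le> (SUP z\<in>K. \<bar>h j z\<bar>)"
    using assms by (intro cSUP_upper)
  also have "\<dots> \<le> Max ((\<lambda>j. SUP z\<in>K. \<bar>h j z\<bar>) ` {1..N})"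
    using assms by (intro Max_ge) auto
  finally show ?thesis .
qed

lemma abs_le_max_sup_fst:
  assumes "compact K" "edelstein_contraction (s j)" "j \<in> {1..N}" "z \<in> K"
  shows "\<bar>s j (fst z)\<bar> \<le> max_sup_fst N K s"
proof -
  have "continuous_on K (\<lambda>z. s j (fst z))"
    by (rule continuous_on_compose2[OF edelstein_contraction_continuous[OF assms(2), of UNIV]])
      (auto intro: continuous_intros)
  from abs_le_max_SUP[of K "\<lambda>j z. s j (fst z)", OF assms(1) this assms(3,4)]
  show ?thesis by (simp add: max_sup_fst_def case_prod_beta)
qed

lemma abs_le_max_sup_snd:
  assumes "compact K" "edelstein_contraction (r j)" "j \<in> {1..N}" "z \<in> K"
  shows "\<bar>r j (snd z)\<bar> \<le> max_sup_snd N K r"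
proof -
  have "continuous_on K (\<lambda>z. r j (snd z))"
    by (rule continuous_on_compose2[OF edelstein_contraction_continuous[OF assms(2), of UNIV]])
      (auto intro: continuous_intros)
  from abs_le_max_SUP[of K "\<lambda>j z. r j (snd z)", OF assms(1) this assms(3,4)]
  show ?thesis by (simp add: max_sup_snd_def case_prod_beta)
qed

section \<open>Preimages under the affine maps\<close>

lemma L_map_surj:
  assumes "unit_partition N t" "x \<in> {0..1}"
  obtains j y where "j \<in> {1..N}" "y \<in> {0..1}" "x = L_map N t j y"
proof -
  have t: "t 0 = 0" "t N = 1" "\<And>j. j < N \<Longrightarrow> t j < t (Suc j)"
    using assms by (auto simp: unit_partition_def)
  \<comment> \<open>Induction on the right end \<open>t n\<close>: a point
    \<open>x \<le> t (Suc n)\<close> either satisfies \<open>x \<le> t n\<close> or lies in the last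
    interval. It starts at 1, the first index of an interval.\<close>
  have "\<exists>j\<in>{1..n}. t (j - 1) \<le> x \<and> x \<le> t j" if "1 \<le> n" "x \<le> t n" for n
    using that
  proof (induction n rule: dec_induct)
    case base
    then show ?case using t assms by auto
  next
    case (step n)
    then show ?case by (cases "x \<le> t n") force+
  qed
  moreover have "1 \<le> N" using t by (cases N) auto
  moreover have "x \<le> t N" using assms t by simp
  ultimately obtain j where j: "j \<in> {1..N}" "t (j - 1) \<le> x" "x \<le> t j"
    by blast
  have "t (j - 1) < t j" using t(3)[of "j - 1"] j by auto
  \<comment> \<open>The witness inverts the affine map, whose denominator \<open>t N - t 0\<close>
    is 1.\<close>
  then show thesis
    using j t that[of j "(x - t (j - 1)) / (t j - t (j - 1))"]
    by (auto simp: L_map_def)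
qed

section \<open>The taxicab metric and the fibre maps\<close>

definition taxicab :: "real \<times> real \<Rightarrow> real \<times> real \<Rightarrow> real" where
  "taxicab z w = \<bar>fst z - fst w\<bar> + \<bar>snd z - snd w\<bar>"

lemma taxicab_triangle: "taxicab x z \<le> taxicab x y + taxicab y z"
  unfolding taxicab_def by linarith

lemma taxicab_le_dist: "taxicab x y \<le> 2 * dist x y"
  using dist_fst_le[of x y] dist_snd_le[of x y] by (simp add: taxicab_def dist_real_def)

text \<open>The two bounds on the scaling functions concern the column sums of the coefficient
  matrix, so the matrix is non-expansive in the taxicab norm. Strictness comes from
  \<open>s j\<close> or \<open>r j\<close>, since distinct points differ in some coordinate.\<close>

lemma F_map_taxicab_less:
  assumes "edelstein_contraction (s j)" "edelstein_contraction (r j)"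
    and "\<bar>\<alpha> j x\<bar> + \<bar>\<gamma> j x\<bar> \<le> 1" "\<bar>\<beta> j x\<bar> + \<bar>\<delta> j x\<bar> \<le> 1" "z \<noteq> w"
  shows "taxicab (F_map s r \<alpha> \<beta> \<gamma> \<delta> p q j x z) (F_map s r \<alpha> \<beta> \<gamma> \<delta> p q j x w) < taxicab z w"
proof -
  define S R where "S = s j (fst z) - s j (fst w)" and "R = r j (snd z) - r j (snd w)"
  have "taxicab (F_map s r \<alpha> \<beta> \<gamma> \<delta> p q j x z) (F_map s r \<alpha> \<beta> \<gamma> \<delta> p q j x w)
      = \<bar>\<alpha> j x * S + \<beta> j x * R\<bar> + \<bar>\<gamma> j x * S + \<delta> j x * R\<bar>"
    by (simp add: taxicab_def F_map_def S_def R_def case_prod_beta algebra_simps)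
  also have "\<dots> \<le> (\<bar>\<alpha> j x\<bar> + \<bar>\<gamma> j x\<bar>) * \<bar>S\<bar> + (\<bar>\<beta> j x\<bar> + \<bar>\<delta> j x\<bar>) * \<bar>R\<bar>"
    using abs_triangle_ineq[of "\<alpha> j x * S" "\<beta> j x * R"] abs_triangle_ineq[of "\<gamma> j x * S" "\<delta> j x * R"]
    by (simp add: abs_mult algebra_simps)
  also have "\<dots> \<le> \<bar>S\<bar> + \<bar>R\<bar>"
    using assms(3,4) by (intro add_mono mult_left_le_one_le) auto
  also have "\<dots> < taxicab z w"
  proof -
    have "\<bar>S\<bar> \<le> \<bar>fst z - fst w\<bar>" "\<bar>R\<bar> \<le> \<bar>snd z - snd w\<bar>"
      using assms(1,2)[THEN edelstein_contraction_dist_le] by (auto simp: S_def R_def dist_real_def)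
    moreover have "\<bar>S\<bar> < \<bar>fst z - fst w\<bar>" if "fst z \<noteq> fst w"
      using assms(1) that by (auto simp: S_def edelstein_contraction_def dist_real_def)
    moreover have "\<bar>R\<bar> < \<bar>snd z - snd w\<bar>" if "snd z \<noteq> snd w"
      using assms(2) that by (auto simp: R_def edelstein_contraction_def dist_real_def)
    moreover have "fst z \<noteq> fst w \<or> snd z \<noteq> snd w"
      using assms(5) by (auto simp: prod_eq_iff)
    ultimately show ?thesis unfolding taxicab_def by linarith
  qed
  finally show ?thesis .
qed

section \<open>Fractal functions take values in the fibre\<close>

lemma admissible_system_continuous:
  assumes "admissible_system N t u v s r \<alpha> \<beta> \<gamma> \<delta> p q" "j \<in> {1..N}"
  shows "continuous_on {0..1} (\<alpha> j)" "continuous_on {0..1} (\<beta> j)" "continuous_on {0..1} (\<gamma> j)"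
    "continuous_on {0..1} (\<delta> j)" "continuous_on {0..1} (p j)" "continuous_on {0..1} (q j)"
  using assms lipschitz_unit_continuous unfolding admissible_system_def by blast+

lemma admissible_system_bounds:
  assumes "admissible_system N t u v s r \<alpha> \<beta> \<gamma> \<delta> p q" "j \<in> {1..N}"
  shows "sup_norm (\<alpha> j) + sup_norm (\<gamma> j) \<le> 1" "sup_norm (\<beta> j) + sup_norm (\<delta> j) \<le> 1"
  using assms unfolding admissible_system_def by blast+

text \<open>The characterisation of \<open>f\<close> does not mention \<open>K\<close>; membership
  is what makes the suprema of \<open>s\<close> and \<open>r\<close> over \<open>K\<close>
  applicable along the graph.\<close>

lemma vector_fractal_function_in_fibre:
  assumes part: "unit_partition N t"
    and ed: "\<And>j. j \<in> {1..N} \<Longrightarrow> edelstein_contraction (s j)"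
      "\<And>j. j \<in> {1..N} \<Longrightarrow> edelstein_contraction (r j)"
    and adm: "admissible_system N t u v s r \<alpha> \<beta> \<gamma> \<delta> p q"
    and K: "compact K" "K \<noteq> {}"
    and inv: "invariant_fibre N K (F_map s r \<alpha> \<beta> \<gamma> \<delta> p q)"
    and f: "vector_fractal_function N t u v (F_map s r \<alpha> \<beta> \<gamma> \<delta> p q) f"
    and "x \<in> {0..1}"
  shows "f x \<in> K"
proof -
  \<comment> \<open>The distance to \<open>K\<close> in the metric that the fibre maps decrease. It
    is attained by compactness, and it is Lipschitz for the Euclidean distance, so
    \<open>h (f x)\<close> has a maximum on [0,1].\<close>
  define h where "h z = (INF y\<in>K. taxicab z y)" for z
  have bdd: "bdd_below (taxicab z ` K)" for z
    by (rule bdd_belowI[of _ 0]) (auto simp: taxicab_def)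
  have h_le: "h z \<le> taxicab z y" if "y \<in> K" for z y
    unfolding h_def using bdd that by (rule cINF_lower)
  have h_attained: "\<exists>y\<in>K. h z = taxicab z y" for z
  proof -
    have "continuous_on K (taxicab z)"
      unfolding taxicab_def by (intro continuous_intros)
    with K obtain y where y: "y \<in> K" "\<forall>w\<in>K. taxicab z y \<le> taxicab z w"
      using continuous_attains_inf by blast
    then have "taxicab z y \<le> h z"
      unfolding h_def using K by (intro cINF_greatest) auto
    with h_le[OF y(1)] y(1) show ?thesis by (intro bexI[of _ y] antisym)
  qed
  have h_diff: "h z - h w \<le> 2 * dist z w" for z w
  proof -
    obtain y where "y \<in> K" "h w = taxicab w y" using h_attained by blast
    then show ?thesis
      using h_le[of y z] taxicab_triangle[of z y w] taxicab_le_dist[of z w] by linarith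
  qed
  have "2-lipschitz_on UNIV h"
  proof (rule lipschitz_onI)
    fix z w
    show "dist (h z) (h w) \<le> 2 * dist z w"
      using h_diff[of z w] h_diff[of w z] by (simp add: dist_real_def dist_commute)
  qed simp
  then have "continuous_on {0..1} (\<lambda>x. h (f x))"
    using f unfolding vector_fractal_function_def
    by (auto intro: continuous_on_compose2[OF lipschitz_on_continuous_on])
  then obtain m where m: "m \<in> {0..1}" "\<And>x. x \<in> {0..1} \<Longrightarrow> h (f x) \<le> h (f m)"
    using continuous_attains_sup[of "{0..1::real}" "\<lambda>x. h (f x)"] by auto
  obtain j y where jy: "j \<in> {1..N}" "y \<in> {0..1}" "m = L_map N t j y"
    using L_map_surj[OF part m(1)] by blast
  let ?F = "F_map s r \<alpha> \<beta> \<gamma> \<delta> p q j y"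
  obtain w where w: "w \<in> K" "h (f y) = taxicab (f y) w" using h_attained by blast
  have fm: "f m = ?F (f y)" using f jy by (auto simp: vector_fractal_function_def)
  have Fw: "?F w \<in> K" using inv jy w unfolding invariant_fibre_def by blast
  \<comment> \<open>Here \<open>w\<close> is a point of \<open>K\<close> nearest to
    \<open>f y\<close>. Otherwise \<open>h (f m) \<le> taxicab (f m) (?F w) < taxicab (f y) w = h (f
    y) \<le> h (f m)\<close>. Hence \<open>f m = ?F w\<close> lies in \<open>K\<close>, and the
    maximum is 0.\<close>
  have "f y = w"
  proof (rule ccontr)
    assume "f y \<noteq> w"
    note c = admissible_system_continuous[OF adm jy(1), THEN abs_le_sup_norm, OF jy(2)]
      and b = admissible_system_bounds[OF adm jy(1)]
    have "taxicab (f m) (?F w) < taxicab (f y) w"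
      unfolding fm by (rule F_map_taxicab_less) (use ed jy c b \<open>f y \<noteq> w\<close> in auto)
    with h_le[OF Fw, of "f m"] m(2)[OF jy(2)] w show False by simp
  qed
  then have "h (f m) \<le> 0" using h_le[OF Fw, of "f m"] fm by (simp add: taxicab_def)
  with m(2)[OF \<open>x \<in> {0..1}\<close>] have "h (f x) \<le> 0" by linarith
  then obtain y where "y \<in> K" "taxicab (f x) y \<le> 0" using h_attained by metis
  moreover from this have "f x = y" by (auto simp: taxicab_def prod_eq_iff)
  ultimately show ?thesis by simp
qed

section \<open>Perturbed coefficients and a pair of linear inequalities\<close>

lemma affine_perturbation_le:
  fixes \<alpha> :: real
  assumes "\<bar>\<alpha>\<bar> \<le> a" "\<bar>\<beta>\<bar> \<le> b" "\<bar>S'\<bar> \<le> Ms" "\<bar>R'\<bar> \<le> Mr"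
    and "\<bar>\<alpha> - \<alpha>'\<bar> \<le> da" "\<bar>\<beta> - \<beta>'\<bar> \<le> db" "\<bar>p - p'\<bar> \<le> dp"
  shows "\<bar>(\<alpha> * S + \<beta> * R + p) - (\<alpha>' * S' + \<beta>' * R' + p')\<bar>
    \<le> a * \<bar>S - S'\<bar> + b * \<bar>R - R'\<bar> + (Ms * da + Mr * db + dp)"
proof -
  \<comment> \<open>The mixed terms are split so that the unprimed coefficients multiply
    \<open>S - S'\<close> and \<open>R - R'\<close>, while the coefficient differences multiply
    \<open>S'\<close> and \<open>R'\<close>, for which bounds are assumed.\<close>
  have "(\<alpha> * S + \<beta> * R + p) - (\<alpha>' * S' + \<beta>' * R' + p')
    = \<alpha> * (S - S') + \<beta> * (R - R') + (S' * (\<alpha> - \<alpha>') + R' * (\<beta> - \<beta>') + (p - p'))"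
    by (simp add: algebra_simps)
  moreover have "\<bar>\<alpha> * (S - S')\<bar> \<le> a * \<bar>S - S'\<bar>" "\<bar>\<beta> * (R - R')\<bar> \<le> b * \<bar>R - R'\<bar>"
    using assms by (auto simp: abs_mult intro!: mult_right_mono)
  moreover have "\<bar>S' * (\<alpha> - \<alpha>')\<bar> \<le> Ms * da" "\<bar>R' * (\<beta> - \<beta>')\<bar> \<le> Mr * db"
    unfolding abs_mult using assms by (intro mult_mono; linarith)+
  moreover have "\<bar>x1 + x2 + (x3 + x4 + x5)\<bar> \<le> y1 + y2 + (y3 + y4 + y5)"
    if "\<bar>x1\<bar> \<le> y1" "\<bar>x2\<bar> \<le> y2" "\<bar>x3\<bar> \<le> y3" "\<bar>x4\<bar> \<le> y4" "\<bar>x5\<bar> \<le> y5"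
    for x1 x2 x3 x4 x5 y1 y2 y3 y4 y5 :: real
    using that by linarith
  ultimately show ?thesis using assms(7) by presburger
qed

text \<open>The first inequality is multiplied by \<open>1 - d > 0\<close>, the second by
  \<open>b \<ge> 0\<close>, and the terms in \<open>Y\<close> cancel. The factor
  \<open>1 - d\<close> preserves strictness of the first. The coefficients of \<open>A\<close> and
  \<open>B\<close> form the first row of the inverse of the matrix with rows
  \<open>(1 - a, - b)\<close> and \<open>(- c, 1 - d)\<close>.\<close>

lemma two_by_two_elimination:
  fixes X :: real
  assumes "X \<le> a * X + b * Y + A" "Y \<le> c * X + d * Y + B"
    and "0 \<le> b" "d < 1" "(1 - a) * (1 - d) - b * c > 0"
  shows "X \<le> (1 - d) / ((1 - a) * (1 - d) - b * c) * A + b / ((1 - a) * (1 - d) - b * c) * B" (is ?le)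
    and "X < a * X + b * Y + A \<Longrightarrow>
      X < (1 - d) / ((1 - a) * (1 - d) - b * c) * A + b / ((1 - a) * (1 - d) - b * c) * B"
proof -
  let ?D = "(1 - a) * (1 - d) - b * c"
  have Y: "b * ((1 - d) * Y) \<le> b * (c * X + B)"
    using assms by (intro mult_left_mono) (auto simp: algebra_simps)
  have eq: "(1 - d) / ?D * A + b / ?D * B = ((1 - d) * A + b * B) / ?D"
    by (simp add: add_divide_distrib)
  have "(1 - d) * X \<le> (1 - d) * (a * X + b * Y + A)"
    using assms by (intro mult_left_mono) auto
  with Y have "X * ?D \<le> (1 - d) * A + b * B" by (simp add: algebra_simps)
  then show ?le unfolding eq using assms(5) by (simp add: pos_le_divide_eq)
  assume "X < a * X + b * Y + A"
  then have "(1 - d) * X < (1 - d) * (a * X + b * Y + A)"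
    using assms by (intro mult_strict_left_mono) auto
  with Y have "X * ?D < (1 - d) * A + b * B" by (simp add: algebra_simps)
  then show "X < (1 - d) / ?D * A + b / ?D * B"
    unfolding eq using assms(5) by (simp add: pos_less_divide_eq)
qed

section \<open>Comparison of the two fractal functions\<close>

theorem theorem8:
  fixes N :: nat
    and t u v :: "nat \<Rightarrow> real"
    and s r :: "nat \<Rightarrow> real \<Rightarrow> real"
    and \<alpha> \<beta> \<gamma> \<delta> p q :: "nat \<Rightarrow> real \<Rightarrow> real"
    and \<alpha>' \<beta>' \<gamma>' \<delta>' p' q' :: "nat \<Rightarrow> real \<Rightarrow> real"
    and K :: "(real \<times> real) set"
    and f f' :: "real \<Rightarrow> real \<times> real"
    and a b c d A B bound :: real
  assumes "N \<ge> 2"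
    and "unit_partition N t"
    and "\<And>j. j \<in> {1..N} \<Longrightarrow> edelstein_contraction (s j)"
    and "\<And>j. j \<in> {1..N} \<Longrightarrow> edelstein_contraction (r j)"
    and "admissible_system N t u v s r \<alpha> \<beta> \<gamma> \<delta> p q"
    and "admissible_system N t u v s r \<alpha>' \<beta>' \<gamma>' \<delta>' p' q'"
    and "compact K" and "K \<noteq> {}"
    and "invariant_fibre N K (F_map s r \<alpha> \<beta> \<gamma> \<delta> p q)"
    and "invariant_fibre N K (F_map s r \<alpha>' \<beta>' \<gamma>' \<delta>' p' q')"
    and "vector_fractal_function N t u v (F_map s r \<alpha> \<beta> \<gamma> \<delta> p q) f"
    and "vector_fractal_function N t u v (F_map s r \<alpha>' \<beta>' \<gamma>' \<delta>' p' q') f'"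
  defines "a \<equiv> max_sup_norm N \<alpha>"
    and "b \<equiv> max_sup_norm N \<beta>"
    and "c \<equiv> max_sup_norm N \<gamma>"
    and "d \<equiv> max_sup_norm N \<delta>"
    and "A \<equiv> max_sup_fst N K s * max_sup_dist N \<alpha> \<alpha>' + max_sup_snd N K r * max_sup_dist N \<beta> \<beta>'
             + max_sup_dist N p p'"
    and "B \<equiv> max_sup_fst N K s * max_sup_dist N \<gamma> \<gamma>' + max_sup_snd N K r * max_sup_dist N \<delta> \<delta>'
             + max_sup_dist N q q'"
    and "bound \<equiv> (1 - d) / ((1 - a) * (1 - d) - b * c) * A + b / ((1 - a) * (1 - d) - b * c) * B"
  assumes "(1 - a) * (1 - d) - b * c > 0"
  shows "sup_norm (\<lambda>x. fst (f x) - fst (f' x)) \<le> bound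
     \<and> (A < bound \<longrightarrow> sup_norm (\<lambda>x. fst (f x) - fst (f' x)) < bound)"
proof -
  note part = assms(2) and ed = assms(3,4) and adm = assms(5) and adm' = assms(6)
    and K = assms(7,8) and f = assms(11) and f' = assms(12)
  note cont = admissible_system_continuous[OF adm] and cont' = admissible_system_continuous[OF adm']
  have cf: "continuous_on {0..1} f" "continuous_on {0..1} f'"
    using f f' by (auto simp: vector_fractal_function_def)
  let ?g = "\<lambda>x. fst (f x) - fst (f' x)" and ?h = "\<lambda>x. snd (f x) - snd (f' x)"
  define X Y where "X = sup_norm ?g" and "Y = sup_norm ?h"
  have cg: "continuous_on {0..1} ?g" and ch: "continuous_on {0..1} ?h"
    using cf by (auto intro!: continuous_intros)
  have XY: "0 \<le> X" "0 \<le> Y" "\<And>x. x \<in> {0..1} \<Longrightarrow> \<bar>?g x\<bar> \<le> X" "\<And>x. x \<in> {0..1} \<Longrightarrow> \<bar>?h x\<bar> \<le> Y"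
    unfolding X_def Y_def by (intro sup_norm_nonneg abs_le_sup_norm cg ch; assumption)+
  have "1 \<in> {1..N}" using assms(1) by simp
  have nonneg: "0 \<le> max_sup_norm N g" if "\<And>j. j \<in> {1..N} \<Longrightarrow> continuous_on {0..1} (g j)" for g
    using sup_norm_nonneg[OF that] sup_norm_le_max_sup_norm[of 1 N g] \<open>1 \<in> {1..N}\<close> by force
  have abcd: "0 \<le> a" "0 \<le> b" "0 \<le> c" "0 \<le> d"
    unfolding a_def b_def c_def d_def by (intro nonneg cont; assumption)+
  \<comment> \<open>The aim is \<open>d < 1\<close>, needed for the elimination:
    \<open>d \<le> 1\<close> holds by admissibility, and \<open>d = 1\<close> would make
    \<open>(1 - a) * (1 - d)\<close> vanish although it exceeds
    \<open>b * c \<ge> 0\<close>.\<close>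
  have "sup_norm (\<alpha> j) \<le> 1" "sup_norm (\<delta> j) \<le> 1" if "j \<in> {1..N}" for j
    using cont[OF that, THEN sup_norm_nonneg] admissible_system_bounds[OF adm that] by linarith+
  then have "a \<le> 1" "d \<le> 1"
    unfolding a_def d_def using assms(1) by (auto intro!: max_sup_norm_le)
  moreover have "0 < (1 - a) * (1 - d)"
    using assms(20) mult_nonneg_nonneg[OF abcd(2,3)] by linarith
  ultimately have "d < 1" by (cases "d = 1") auto

  let ?S = "\<lambda>j x. \<bar>s j (fst (f x)) - s j (fst (f' x))\<bar>"
    and ?R = "\<lambda>j x. \<bar>r j (snd (f x)) - r j (snd (f' x))\<bar>"
  \<comment> \<open>The differences of \<open>s j\<close> and \<open>r j\<close> are kept instead of
    \<open>X\<close> and \<open>Y\<close>, because the strict estimate uses the gap between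
    them.\<close>
  have step: "\<bar>?g (L_map N t j x)\<bar> \<le> a * ?S j x + b * ?R j x + A"
    "\<bar>?h (L_map N t j x)\<bar> \<le> c * ?S j x + d * ?R j x + B"
    if j: "j \<in> {1..N}" and x: "x \<in> {0..1}" for j x
  proof -
    \<comment> \<open>The coefficient differences in \<open>A\<close> and \<open>B\<close> are
      multiplied by the values of \<open>s j\<close> and \<open>r j\<close> at
      \<open>f' x\<close>.\<close>
    have "f' x \<in> K"
      by (rule vector_fractal_function_in_fibre[OF part ed adm' K assms(10) f' x])
    then have "\<bar>s j (fst (f' x))\<bar> \<le> max_sup_fst N K s" "\<bar>r j (snd (f' x))\<bar> \<le> max_sup_snd N K r"
      by (intro abs_le_max_sup_fst abs_le_max_sup_snd K ed j; assumption)+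
    note * = affine_perturbation_le[OF _ _ this]
    have fL: "f (L_map N t j x) = F_map s r \<alpha> \<beta> \<gamma> \<delta> p q j x (f x)"
      "f' (L_map N t j x) = F_map s r \<alpha>' \<beta>' \<gamma>' \<delta>' p' q' j x (f' x)"
      using f f' j x by (auto simp: vector_fractal_function_def)
    show "\<bar>?g (L_map N t j x)\<bar> \<le> a * ?S j x + b * ?R j x + A"
      unfolding fL F_map_def case_prod_beta fst_conv a_def b_def A_def
      by (intro * abs_le_max_sup_norm abs_diff_le_max_sup_dist cont cont' j x; assumption)
    show "\<bar>?h (L_map N t j x)\<bar> \<le> c * ?S j x + d * ?R j x + B"
      unfolding fL F_map_def case_prod_beta snd_conv c_def d_def B_def
      by (intro * abs_le_max_sup_norm abs_diff_le_max_sup_dist cont cont' j x; assumption)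
  qed
  have SR: "?S j x \<le> X" "?R j x \<le> Y" "0 < X \<Longrightarrow> ?S j x < X" "0 < Y \<Longrightarrow> ?R j x < Y"
    if j: "j \<in> {1..N}" and x: "x \<in> {0..1}" for j x
    using ed[OF j, THEN edelstein_contraction_abs_le] ed[OF j, THEN edelstein_contraction_abs_less]
      XY(3,4)[OF x] by blast+

  obtain m where m: "m \<in> {0..1}" "X = \<bar>?g m\<bar>"
    using sup_norm_attained[OF cg] unfolding X_def by metis
  obtain j x where jx: "j \<in> {1..N}" "x \<in> {0..1}" "m = L_map N t j x"
    using L_map_surj[OF part m(1)] by blast
  have X: "X \<le> a * ?S j x + b * ?R j x + A" using step(1)[OF jx(1,2)] m(2) jx(3) by simp
  have aS: "a * ?S j x \<le> a * X" and bR: "b * ?R j x \<le> b * Y"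
    using SR(1,2)[OF jx(1,2)] abcd by (auto intro: mult_left_mono)
  have 1: "X \<le> a * X + b * Y + A" using X aS bR by linarith

  obtain n where n: "n \<in> {0..1}" "Y = \<bar>?h n\<bar>"
    using sup_norm_attained[OF ch] unfolding Y_def by metis
  obtain k y where ky: "k \<in> {1..N}" "y \<in> {0..1}" "n = L_map N t k y"
    using L_map_surj[OF part n(1)] by blast
  have Y: "Y \<le> c * ?S k y + d * ?R k y + B" using step(2)[OF ky(1,2)] n(2) ky(3) by simp
  moreover have "c * ?S k y \<le> c * X" "d * ?R k y \<le> d * Y"
    using SR(1,2)[OF ky(1,2)] abcd by (auto intro: mult_left_mono)
  ultimately have 2: "Y \<le> c * X + d * Y + B" by linarith

  note elim = two_by_two_elimination[OF 1 2 \<open>0 \<le> b\<close> \<open>d < 1\<close> assms(20), folded bound_def]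
  \<comment> \<open>If \<open>X \<ge> bound\<close>, the elimination forces equality in the first
    inequality. A positive \<open>a * X\<close> or \<open>b * Y\<close> would make it strict, so
    both vanish and \<open>X \<le> A < bound\<close>, a contradiction.\<close>
  have "X < bound" if "A < bound"
  proof (rule ccontr)
    assume "\<not> X < bound"
    then have ns: "\<not> X < a * X + b * Y + A" and "A < X" using elim(2) that by auto
    have "a * ?S j x < a * X" if "0 < a * X"
      using that SR(3)[OF jx(1,2)] XY abcd by (auto simp: zero_less_mult_iff)
    moreover have "b * ?R j x < b * Y" if "0 < b * Y"
      using that SR(4)[OF jx(1,2)] XY abcd by (auto simp: zero_less_mult_iff)
    moreover have "0 \<le> a * X" "0 \<le> b * Y" using XY abcd by auto
    ultimately have "a * X = 0" "b * Y = 0" using ns X aS bR by linarith+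
    with 1 \<open>A < X\<close> show False by linarith
  qed
  with elim(1) show ?thesis unfolding X_def by blast
qed

end
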